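(* Suppose that $R$ is a commutative reduced Bézout weak Baer ring with classical ring of quotients $Q$. Then $R\propto Q/R$ is morphic.
   Context: All rings are associative with identity. A commutative ring is Bézout if every finitely generated ideal is principal. A commutative ring is weak Baer if the annihilator of every element is generated by an idempotent. The classical ring of quotients $Q$ of a commutative ring $R$ is the localization of $R$ at the set of all nonzerodivisors of $R$. For a commutative ring $R$ and an $R$-module $M$ (viewed as an $(R,R)$-bimodule with $mr=rm$), the trivial extension $R\propto M$ is the commutative ring of pairs $(r,m)$ with $r\in R$, $m\in M$, with componentwise addition and multiplication $(r,m)(s,n)=(rs,rn+ms)$. A commutative ring $S$ is morphic if for every $a\in S$ one has $S/Sa\cong\{x\in S: xa=0\}$ as $S$-modules. *)

theory Defs
  imports "HOL-Algebra.Module" "HOL-Algebra.QuotRing"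
begin

section \<open>Classes of commutative rings\<close>

definition annihilator :: "('a, 'b) ring_scheme \<Rightarrow> 'a \<Rightarrow> 'a set"
  where "annihilator R a = {x \<in> carrier R. x \<otimes>\<^bsub>R\<^esub> a = \<zero>\<^bsub>R\<^esub>}"

definition nonzerodivisors :: "('a, 'b) ring_scheme \<Rightarrow> 'a set"
  where "nonzerodivisors R =
    {s \<in> carrier R. \<forall>x \<in> carrier R. x \<otimes>\<^bsub>R\<^esub> s = \<zero>\<^bsub>R\<^esub> \<longrightarrow> x = \<zero>\<^bsub>R\<^esub>}"

locale reduced_cring = cring +
  assumes reduced: "\<lbrakk> x \<in> carrier R; x [^] (n::nat) = \<zero> \<rbrakk> \<Longrightarrow> x = \<zero>"

locale bezout_cring = cring +
  assumes bezout: "\<lbrakk> finite A; A \<subseteq> carrier R \<rbrakk> \<Longrightarrow> principalideal (Idl A) R"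

locale weak_baer_cring = cring +
  assumes weak_baer:
    "a \<in> carrier R \<Longrightarrow> \<exists>e \<in> carrier R. e \<otimes> e = e \<and> annihilator R a = PIdl e"

section \<open>Modules\<close>

text \<open>
  The record type for modules extends the one for rings, but the locale \<^locale>\<open>module\<close> does not
  refer to the fields \<^const>\<open>mult\<close> and \<^const>\<open>one\<close> of a module. Where no multiplication is
  available they are filled with arbitrary values.
\<close>

definition ring_as_module :: "('a, 'b) ring_scheme \<Rightarrow> ('a, 'a) module"
  where "ring_as_module R =
    \<lparr>carrier = carrier R, mult = mult R, one = \<one>\<^bsub>R\<^esub>, zero = \<zero>\<^bsub>R\<^esub>, add = add R,
     smult = mult R\<rparr>"

text \<open>Scalar multiplication on cosets is \<open>r (N + x) = N + r x\<close>, written as a union over all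
  representatives \<open>x\<close> of the coset.\<close>

definition quotient_module :: "('a, 'm, 'b) module_scheme \<Rightarrow> 'm set \<Rightarrow> ('a, 'm set) module"
  where "quotient_module M N =
    \<lparr>carrier = a_rcosets\<^bsub>M\<^esub> N, mult = undefined, one = undefined, zero = N, add = set_add M,
     smult = (\<lambda>r X. \<Union>x\<in>X. N +>\<^bsub>M\<^esub> (r \<odot>\<^bsub>M\<^esub> x))\<rparr>"

definition module_iso ::
  "('a, 'c) ring_scheme \<Rightarrow> ('a, 'm, 'd) module_scheme \<Rightarrow> ('a, 'n, 'e) module_scheme \<Rightarrow> ('m \<Rightarrow> 'n) set"
  where "module_iso R M N =
    {h \<in> iso (add_monoid M) (add_monoid N).
       \<forall>r \<in> carrier R. \<forall>x \<in> carrier M. h (r \<odot>\<^bsub>M\<^esub> x) = r \<odot>\<^bsub>N\<^esub> h x}"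

definition module_isomorphic ::
  "('a, 'c) ring_scheme \<Rightarrow> ('a, 'm, 'd) module_scheme \<Rightarrow> ('a, 'n, 'e) module_scheme \<Rightarrow> bool"
  where "module_isomorphic R M N \<longleftrightarrow> module_iso R M N \<noteq> {}"

locale morphic_cring = cring +
  assumes morphic: "a \<in> carrier R \<Longrightarrow>
    module_isomorphic R
      (quotient_module (ring_as_module R) (PIdl a))
      ((ring_as_module R)\<lparr>carrier := annihilator R a\<rparr>)"

section \<open>Localization\<close>

text \<open>The localization of a commutative ring \<open>R\<close> at a multiplicative set \<open>S\<close>. The fraction
  \<open>a/s\<close> is the equivalence class of the pair \<open>(a, s)\<close>.\<close>

definition frac_rel :: "('a, 'b) ring_scheme \<Rightarrow> 'a set \<Rightarrow> (('a \<times> 'a) \<times> ('a \<times> 'a)) set"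
  where "frac_rel R S =
    {((a, s), (b, t)). a \<in> carrier R \<and> b \<in> carrier R \<and> s \<in> S \<and> t \<in> S \<and>
       (\<exists>u \<in> S. u \<otimes>\<^bsub>R\<^esub> (t \<otimes>\<^bsub>R\<^esub> a) = u \<otimes>\<^bsub>R\<^esub> (s \<otimes>\<^bsub>R\<^esub> b))}"

definition frac :: "('a, 'b) ring_scheme \<Rightarrow> 'a set \<Rightarrow> 'a \<Rightarrow> 'a \<Rightarrow> ('a \<times> 'a) set"
  where "frac R S a s = frac_rel R S `` {(a, s)}"

definition localization :: "('a, 'b) ring_scheme \<Rightarrow> 'a set \<Rightarrow> ('a \<times> 'a) set ring"
  where "localization R S =
    \<lparr>carrier = (carrier R \<times> S) // frac_rel R S,
     mult = (\<lambda>X Y. \<Union>(a, s)\<in>X. \<Union>(b, t)\<in>Y. frac R S (a \<otimes>\<^bsub>R\<^esub> b) (s \<otimes>\<^bsub>R\<^esub> t)),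
     one = frac R S \<one>\<^bsub>R\<^esub> \<one>\<^bsub>R\<^esub>,
     zero = frac R S \<zero>\<^bsub>R\<^esub> \<one>\<^bsub>R\<^esub>,
     add = (\<lambda>X Y. \<Union>(a, s)\<in>X. \<Union>(b, t)\<in>Y.
              frac R S ((t \<otimes>\<^bsub>R\<^esub> a) \<oplus>\<^bsub>R\<^esub> (s \<otimes>\<^bsub>R\<^esub> b)) (s \<otimes>\<^bsub>R\<^esub> t))\<rparr>"

definition classical_quotients :: "('a, 'b) ring_scheme \<Rightarrow> ('a \<times> 'a) set ring"
  where "classical_quotients R = localization R (nonzerodivisors R)"

definition to_quotients :: "('a, 'b) ring_scheme \<Rightarrow> 'a \<Rightarrow> ('a \<times> 'a) set"
  where "to_quotients R r = frac R (nonzerodivisors R) r \<one>\<^bsub>R\<^esub>"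

definition quotients_module :: "('a, 'b) ring_scheme \<Rightarrow> ('a, ('a \<times> 'a) set) module"
  where "quotients_module R =
    ring.extend (classical_quotients R)
      (module.fields (\<lambda>r q. to_quotients R r \<otimes>\<^bsub>classical_quotients R\<^esub> q))"

text \<open>The \<open>R\<close>-module \<open>Q/R\<close>, where \<open>R\<close> is identified with its image in \<open>Q\<close>.\<close>

definition Q_mod_R :: "('a, 'b) ring_scheme \<Rightarrow> ('a, ('a \<times> 'a) set set) module"
  where "Q_mod_R R = quotient_module (quotients_module R) (to_quotients R ` carrier R)"

section \<open>Trivial extensions\<close>

text \<open>Since \<open>m s = s m\<close> in the bimodule \<open>M\<close>, the second component \<open>r n + m s\<close> of a product is
  written with left scalar multiplication only.\<close>

definition trivial_extension ::
  "('a, 'c) ring_scheme \<Rightarrow> ('a, 'm, 'd) module_scheme \<Rightarrow> ('a \<times> 'm) ring"  (infixl \<open>\<propto>\<close> 65)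
  where "R \<propto> M =
    \<lparr>carrier = carrier R \<times> carrier M,
     mult = (\<lambda>(r, m) (s, n). (r \<otimes>\<^bsub>R\<^esub> s, (r \<odot>\<^bsub>M\<^esub> n) \<oplus>\<^bsub>M\<^esub> (s \<odot>\<^bsub>M\<^esub> m))),
     one = (\<one>\<^bsub>R\<^esub>, \<zero>\<^bsub>M\<^esub>),
     zero = (\<zero>\<^bsub>R\<^esub>, \<zero>\<^bsub>M\<^esub>),
     add = (\<lambda>(r, m) (s, n). (r \<oplus>\<^bsub>R\<^esub> s, m \<oplus>\<^bsub>M\<^esub> n))\<rparr>"

end

theory Submission
  imports Defs
begin

text \<open>
  A commutative ring \<open>S\<close> is morphic as soon as for every \<open>\<alpha>\<close> there is \<open>\<beta>\<close> with \<open>ann \<beta> = S\<alpha>\<close> and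
  \<open>ann \<alpha> = S\<beta>\<close>, since then \<open>S/S\<alpha> = S/ann \<beta>\<close> is isomorphic to \<open>S\<beta> = ann \<alpha>\<close>.

  Let \<open>\<alpha> = (a, m)\<close>. If \<open>ann a = Re\<close> with \<open>e\<close> idempotent and \<open>f = 1 - e\<close>, then \<open>c = a + e\<close> is a
  nonzerodivisor and \<open>a = fc\<close>. By the Bezout property \<open>m = x/s + R\<close> with \<open>ux + vs = 1\<close>, so that
  \<open>Rm\<close> is generated by \<open>1/s + R\<close>. On the \<open>f\<close>-part of the ring \<open>\<alpha>\<close> therefore generates the same
  ideal as \<open>(c, 0)\<close>, and on the \<open>e\<close>-part the same ideal as \<open>(0, 1/s)\<close>. As \<open>(c, 0)\<close> and \<open>(0, 1/c)\<close>
  are annihilators of each other, and likewise for \<open>s\<close>, one can take \<open>\<beta> = (es, f/c)\<close>.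
\<close>

section \<open>Localizations\<close>

text \<open>The operations of \<open>localization\<close> are unions over all representatives. They
  are well defined once every choice of representatives yields the same class; \<open>p\<close> and
  \<open>q\<close> keep the union from being empty.\<close>

lemma UN_pairs_constant:
  assumes "p \<in> X" "q \<in> Y"
    and "\<And>a s b t. (a, s) \<in> X \<Longrightarrow> (b, t) \<in> Y \<Longrightarrow> f a s b t = C"
  shows "(\<Union>(a, s)\<in>X. \<Union>(b, t)\<in>Y. f a s b t) = C"
  using assms by (cases p; cases q) fast

text \<open>Any multiplicatively closed set is allowed, even one with zero divisors: the extra
  factor \<open>u\<close> in \<open>frac_rel\<close> stands in for cancellation.\<close>

locale fractions = cring R + submonoid S R for R (structure) and S
begin

lemma denominator_closed [simp]: "s \<in> S \<Longrightarrow> s \<in> carrier R"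
  using subset by blast

lemma frac_rel_iff:
  "((a, s), (b, t)) \<in> frac_rel R S \<longleftrightarrow> a \<in> carrier R \<and> b \<in> carrier R \<and> s \<in> S \<and> t \<in> S \<and>
     (\<exists>u\<in>S. u \<otimes> (t \<otimes> a) = u \<otimes> (s \<otimes> b))"
  by (simp add: frac_rel_def)

lemma equiv_frac_rel: "equiv (carrier R \<times> S) (frac_rel R S)"
proof (rule equivI)
  show "frac_rel R S \<subseteq> (carrier R \<times> S) \<times> carrier R \<times> S"
    by (auto simp: frac_rel_def)
  show "refl_on (carrier R \<times> S) (frac_rel R S)"
    by (auto simp: refl_on_def frac_rel_iff)
  show "sym (frac_rel R S)"
    unfolding sym_def by (auto simp: frac_rel_iff) metis
  have "((a, s), (c, w)) \<in> frac_rel R S"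
    if "((a, s), (b, t)) \<in> frac_rel R S" "((b, t), (c, w)) \<in> frac_rel R S" for a s b t c w
  proof -
    from that obtain u v where uv: "u \<in> S" "v \<in> S"
      and u: "u \<otimes> (t \<otimes> a) = u \<otimes> (s \<otimes> b)" and v: "v \<otimes> (w \<otimes> b) = v \<otimes> (t \<otimes> c)"
      by (auto simp: frac_rel_iff)
    from that have [simp]: "a \<in> carrier R" "b \<in> carrier R" "c \<in> carrier R"
      and "s \<in> S" "t \<in> S" "w \<in> S"
      by (auto simp: frac_rel_iff)
    have [simp]: "s \<in> carrier R" "t \<in> carrier R" "w \<in> carrier R" "u \<in> carrier R" "v \<in> carrier R"
      using uv \<open>s \<in> S\<close> \<open>t \<in> S\<close> \<open>w \<in> S\<close> by auto
    \<comment> \<open>The middle denominator \<open>t\<close> cannot be cancelled, so it goes into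
      the witness \<open>u \<otimes> v \<otimes> t\<close>.\<close>
    have "(u \<otimes> v \<otimes> t) \<otimes> (w \<otimes> a) = (u \<otimes> (t \<otimes> a)) \<otimes> (v \<otimes> w)" by (simp add: m_ac)
    also have "\<dots> = s \<otimes> u \<otimes> (v \<otimes> (w \<otimes> b))" unfolding u by (simp add: m_ac)
    also have "\<dots> = (u \<otimes> v \<otimes> t) \<otimes> (s \<otimes> c)" unfolding v by (simp add: m_ac)
    finally show ?thesis
      using uv \<open>s \<in> S\<close> \<open>t \<in> S\<close> \<open>w \<in> S\<close> by (auto simp: frac_rel_iff)
  qed
  then show "trans (frac_rel R S)"
    unfolding trans_def by fast
qed

lemma frac_eq_iff:
  assumes "a \<in> carrier R" "s \<in> S" "b \<in> carrier R" "t \<in> S"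
  shows "frac R S a s = frac R S b t \<longleftrightarrow> (\<exists>u\<in>S. u \<otimes> (t \<otimes> a) = u \<otimes> (s \<otimes> b))"
  using assms eq_equiv_class_iff[OF equiv_frac_rel, of "(a, s)" "(b, t)"]
  by (simp add: frac_def frac_rel_iff)

lemma frac_eqI:
  assumes "a \<in> carrier R" "s \<in> S" "b \<in> carrier R" "t \<in> S" "t \<otimes> a = s \<otimes> b"
  shows "frac R S a s = frac R S b t"
  using assms frac_eq_iff by auto

lemma mem_frac_iff:
  assumes "a \<in> carrier R" "s \<in> S"
  shows "(b, t) \<in> frac R S a s \<longleftrightarrow>
    b \<in> carrier R \<and> t \<in> S \<and> (\<exists>u\<in>S. u \<otimes> (t \<otimes> a) = u \<otimes> (s \<otimes> b))"
  using assms by (auto simp: frac_def frac_rel_iff)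

lemma frac_self: "a \<in> carrier R \<Longrightarrow> s \<in> S \<Longrightarrow> (a, s) \<in> frac R S a s"
  by (auto simp: mem_frac_iff)

lemma frac_closed:
  "a \<in> carrier R \<Longrightarrow> s \<in> S \<Longrightarrow> frac R S a s \<in> carrier (localization R S)"
  by (simp add: localization_def frac_def quotientI)

lemma localization_cases:
  assumes "x \<in> carrier (localization R S)"
  obtains a s where "a \<in> carrier R" "s \<in> S" "x = frac R S a s"
  using assms by (auto simp: localization_def frac_def elim!: quotientE)

text \<open>If \<open>u\<close> and \<open>v\<close> witness that the factors are replaced by
  equivalent pairs, then \<open>u \<otimes> v\<close> witnesses that the products are equivalent.
  The same witness serves for sums.\<close>

lemma frac_mult:
  assumes ab: "a \<in> carrier R" "s \<in> S" "b \<in> carrier R" "t \<in> S"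
  shows "frac R S a s \<otimes>\<^bsub>localization R S\<^esub> frac R S b t = frac R S (a \<otimes> b) (s \<otimes> t)"
  unfolding localization_def monoid.simps
proof (rule UN_pairs_constant[OF frac_self frac_self])
  fix a' s' b' t' assume "(a', s') \<in> frac R S a s" "(b', t') \<in> frac R S b t"
  then obtain u v where uv: "u \<in> S" "v \<in> S"
    and u: "u \<otimes> (s' \<otimes> a) = u \<otimes> (s \<otimes> a')" and v: "v \<otimes> (t' \<otimes> b) = v \<otimes> (t \<otimes> b')"
    and ab': "a' \<in> carrier R" "s' \<in> S" "b' \<in> carrier R" "t' \<in> S"
    using ab by (auto simp: mem_frac_iff)
  note [simp] = ab ab' uv
  have [simp]: "s \<in> carrier R" "t \<in> carrier R" "s' \<in> carrier R" "t' \<in> carrier R"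
      "u \<in> carrier R" "v \<in> carrier R"
    using ab ab' uv by auto
  have "(u \<otimes> v) \<otimes> ((s \<otimes> t) \<otimes> (a' \<otimes> b')) = (u \<otimes> (s \<otimes> a')) \<otimes> (v \<otimes> (t \<otimes> b'))" by (simp add: m_ac)
  also have "\<dots> = (u \<otimes> v) \<otimes> ((s' \<otimes> t') \<otimes> (a \<otimes> b))" unfolding u[symmetric] v[symmetric] by (simp add: m_ac)
  finally show "frac R S (a' \<otimes> b') (s' \<otimes> t') = frac R S (a \<otimes> b) (s \<otimes> t)"
    using frac_eq_iff by auto
qed (use ab in auto)


lemma frac_add:
  assumes ab: "a \<in> carrier R" "s \<in> S" "b \<in> carrier R" "t \<in> S"
  shows "frac R S a s \<oplus>\<^bsub>localization R S\<^esub> frac R S b t =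
    frac R S ((t \<otimes> a) \<oplus> (s \<otimes> b)) (s \<otimes> t)"
  unfolding localization_def ring.simps
proof (rule UN_pairs_constant[OF frac_self frac_self])
  fix a' s' b' t' assume "(a', s') \<in> frac R S a s" "(b', t') \<in> frac R S b t"
  then obtain u v where uv: "u \<in> S" "v \<in> S"
    and u: "u \<otimes> (s' \<otimes> a) = u \<otimes> (s \<otimes> a')" and v: "v \<otimes> (t' \<otimes> b) = v \<otimes> (t \<otimes> b')"
    and ab': "a' \<in> carrier R" "s' \<in> S" "b' \<in> carrier R" "t' \<in> S"
    using ab by (auto simp: mem_frac_iff)
  note [simp] = ab ab' uv
  have [simp]: "s \<in> carrier R" "t \<in> carrier R" "s' \<in> carrier R" "t' \<in> carrier R"
      "u \<in> carrier R" "v \<in> carrier R"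
    using ab ab' uv by auto
  \<comment> \<open>Each summand is arranged to contain one side of one of the two witnessing
    equations as a factor, so that the equations can be applied separately.\<close>
  have "(u \<otimes> v) \<otimes> ((s \<otimes> t) \<otimes> (t' \<otimes> a' \<oplus> s' \<otimes> b')) =
      (u \<otimes> (s \<otimes> a')) \<otimes> (v \<otimes> t \<otimes> t') \<oplus> (v \<otimes> (t \<otimes> b')) \<otimes> (u \<otimes> s \<otimes> s')"
    by (simp add: m_ac r_distr)
  also have "\<dots> = (u \<otimes> v) \<otimes> ((s' \<otimes> t') \<otimes> (t \<otimes> a \<oplus> s \<otimes> b))"
    unfolding u[symmetric] v[symmetric] by (simp add: m_ac r_distr)
  finally show "frac R S (t' \<otimes> a' \<oplus> s' \<otimes> b') (s' \<otimes> t') =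
      frac R S (t \<otimes> a \<oplus> s \<otimes> b) (s \<otimes> t)"
    using frac_eq_iff by auto
qed (use ab in auto)

lemma localization_one: "\<one>\<^bsub>localization R S\<^esub> = frac R S \<one> \<one>"
  and localization_zero: "\<zero>\<^bsub>localization R S\<^esub> = frac R S \<zero> \<one>"
  by (simp_all add: localization_def)

lemmas frac_simps = frac_mult frac_add localization_one localization_zero

lemma localization_cring: "cring (localization R S)"
proof (rule cringI)
  let ?L = "localization R S"
  show "abelian_group ?L"
  proof (rule abelian_groupI)
    fix x y z assume "x \<in> carrier ?L" "y \<in> carrier ?L" "z \<in> carrier ?L"
    then show "(x \<oplus>\<^bsub>?L\<^esub> y) \<oplus>\<^bsub>?L\<^esub> z = x \<oplus>\<^bsub>?L\<^esub> (y \<oplus>\<^bsub>?L\<^esub> z)"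
      by (elim localization_cases) (simp add: frac_simps m_ac a_ac r_distr)
  next
    fix x assume "x \<in> carrier ?L"
    then obtain a s where as: "a \<in> carrier R" "s \<in> S" "x = frac R S a s"
      by (rule localization_cases)
    \<comment> \<open>The sum of -a/s and a/s comes out with denominator
      \<open>s \<otimes> s\<close>, whereas zero is 0/1.\<close>
    have "frac R S \<zero> (s \<otimes> s) = frac R S \<zero> \<one>"
      using as by (intro frac_eqI) auto
    then have "frac R S (\<ominus> a) s \<oplus>\<^bsub>?L\<^esub> x = \<zero>\<^bsub>?L\<^esub>"
      using as by (simp add: frac_simps l_neg r_minus)
    then show "\<exists>y\<in>carrier ?L. y \<oplus>\<^bsub>?L\<^esub> x = \<zero>\<^bsub>?L\<^esub>"
      using as frac_closed by blast
  qed (auto simp: frac_simps frac_closed m_ac a_ac elim!: localization_cases intro!: frac_eqI)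
  show "comm_monoid ?L"
    by (rule comm_monoidI)
      (auto simp: frac_simps frac_closed m_ac elim!: localization_cases intro!: frac_eqI)
  fix x y z assume "x \<in> carrier ?L" "y \<in> carrier ?L" "z \<in> carrier ?L"
  then show "(x \<oplus>\<^bsub>?L\<^esub> y) \<otimes>\<^bsub>?L\<^esub> z = x \<otimes>\<^bsub>?L\<^esub> z \<oplus>\<^bsub>?L\<^esub> y \<otimes>\<^bsub>?L\<^esub> z"
    by (elim localization_cases, simp add: frac_simps, intro frac_eqI)
      (simp_all add: m_ac r_distr l_distr)
qed

end

section \<open>Nonzerodivisors as denominators\<close>

lemma (in cring) nonzerodivisors_submonoid: "submonoid (nonzerodivisors R) R"
proof
  fix s t assume st: "s \<in> nonzerodivisors R" "t \<in> nonzerodivisors R"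
  then have [simp]: "s \<in> carrier R" "t \<in> carrier R"
    by (auto simp: nonzerodivisors_def)
  have "x = \<zero>" if x: "x \<in> carrier R" "x \<otimes> (s \<otimes> t) = \<zero>" for x
  proof -
    have "(x \<otimes> s) \<otimes> t = \<zero>" using x by (simp add: m_ac)
    then have "x \<otimes> s = \<zero>" using st(2) x by (simp add: nonzerodivisors_def)
    then show ?thesis using st(1) x by (simp add: nonzerodivisors_def)
  qed
  then show "s \<otimes> t \<in> nonzerodivisors R" by (simp add: nonzerodivisors_def)
qed (auto simp: nonzerodivisors_def)

lemma (in cring) nonzerodivisors_cancel:
  assumes s: "s \<in> nonzerodivisors R" and ab: "a \<in> carrier R" "b \<in> carrier R"
    and eq: "s \<otimes> a = s \<otimes> b"
  shows "a = b"
proof -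
  have [simp]: "s \<in> carrier R" using s by (simp add: nonzerodivisors_def)
  have "(a \<ominus> b) \<otimes> s = a \<otimes> s \<ominus> b \<otimes> s"
    using ab by (simp add: minus_eq l_distr l_minus)
  then have "(a \<ominus> b) \<otimes> s = \<zero>" using eq ab by (simp add: m_comm minus_eq r_neg)
  then have "a \<oplus> \<ominus> b = \<zero>" using s ab by (simp add: nonzerodivisors_def minus_eq)
  then show ?thesis using ab minus_equality[of a "\<ominus> b"] by simp
qed

section \<open>Quotient modules\<close>

lemma (in module) abelian_subgroup_submodule:
  assumes "submodule N R M"
  shows "abelian_subgroup N M"
  using assms by (intro abelian_subgroupI3 additive_subgroup.intro submodule.axioms(1))
    (auto intro: M.abelian_group_axioms)

text \<open>Two representatives of a coset differ by some n in \<open>N\<close>, and their multiples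
  by r differ by rn, again in \<open>N\<close>. Hence the union that defines the scalar
  multiplication is a union of equal cosets.\<close>

lemma (in module) quotient_module_smult:
  assumes N: "submodule N R M" and r: "r \<in> carrier R" and x: "x \<in> carrier M"
  shows "r \<odot>\<^bsub>quotient_module M N\<^esub> (N +>\<^bsub>M\<^esub> x) = N +>\<^bsub>M\<^esub> (r \<odot>\<^bsub>M\<^esub> x)"
proof -
  interpret N: abelian_subgroup N M using abelian_subgroup_submodule[OF N] .
  interpret S: submodule N R M using N .
  have "N +>\<^bsub>M\<^esub> (r \<odot>\<^bsub>M\<^esub> y) = N +>\<^bsub>M\<^esub> (r \<odot>\<^bsub>M\<^esub> x)" if y: "y \<in> N +>\<^bsub>M\<^esub> x" for y
  proof -
    obtain n where n: "n \<in> N" "y = n \<oplus>\<^bsub>M\<^esub> x" using y by (auto simp: a_r_coset_def')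
    then have "r \<odot>\<^bsub>M\<^esub> y = r \<odot>\<^bsub>M\<^esub> n \<oplus>\<^bsub>M\<^esub> r \<odot>\<^bsub>M\<^esub> x"
      using r x by (simp add: smult_r_distr N.a_Hcarr)
    then have "r \<odot>\<^bsub>M\<^esub> y \<in> N +>\<^bsub>M\<^esub> (r \<odot>\<^bsub>M\<^esub> x)"
      using n r by (auto simp: a_r_coset_def')
    then show ?thesis using r x by (metis N.a_repr_independence' smult_closed)
  qed
  moreover have "x \<in> N +>\<^bsub>M\<^esub> x" using x N.a_rcos_self by simp
  ultimately have "(\<Union>y\<in>N +>\<^bsub>M\<^esub> x. N +>\<^bsub>M\<^esub> (r \<odot>\<^bsub>M\<^esub> y)) = N +>\<^bsub>M\<^esub> (r \<odot>\<^bsub>M\<^esub> x)"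
    by (intro UN_constant_eq ballI)
  then show ?thesis by (simp add: quotient_module_def)
qed

lemma (in module) quotient_module_cases:
  assumes "X \<in> carrier (quotient_module M N)"
  obtains x where "x \<in> carrier M" "X = N +>\<^bsub>M\<^esub> x"
  using assms by (auto simp: quotient_module_def A_RCOSETS_def')

lemma (in module) quotient_module_coset_closed:
  "x \<in> carrier M \<Longrightarrow> N +>\<^bsub>M\<^esub> x \<in> carrier (quotient_module M N)"
  by (auto simp: quotient_module_def A_RCOSETS_def')

lemma (in module) quotient_module_zero: "\<zero>\<^bsub>quotient_module M N\<^esub> = N"
  by (simp add: quotient_module_def)

lemma (in module) quotient_module_add:
  assumes "submodule N R M" "x \<in> carrier M" "y \<in> carrier M"
  shows "(N +>\<^bsub>M\<^esub> x) \<oplus>\<^bsub>quotient_module M N\<^esub> (N +>\<^bsub>M\<^esub> y) = N +>\<^bsub>M\<^esub> (x \<oplus>\<^bsub>M\<^esub> y)"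
  using abelian_subgroup.a_rcos_sum[OF abelian_subgroup_submodule] assms
  by (simp add: quotient_module_def)

lemma (in module) coset_eq_iff:
  assumes "submodule N R M" "x \<in> carrier M" "y \<in> carrier M"
  shows "N +>\<^bsub>M\<^esub> x = N +>\<^bsub>M\<^esub> y \<longleftrightarrow> x \<in> N +>\<^bsub>M\<^esub> y"
proof -
  interpret N: abelian_subgroup N M using abelian_subgroup_submodule assms by blast
  show ?thesis using assms N.a_repr_independence' N.a_repr_independenceD by metis
qed

lemma (in module) quotient_module_module:
  assumes N: "submodule N R M"
  shows "module R (quotient_module M N)"
proof -
  interpret N: abelian_subgroup N M using abelian_subgroup_submodule[OF N] .
  \<comment> \<open>Writing \<open>N\<close> as the coset of zero lets the rule for sums of cosets
    treat the zero element as well.\<close>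
  have zero: "\<zero>\<^bsub>quotient_module M N\<^esub> = N +>\<^bsub>M\<^esub> \<zero>\<^bsub>M\<^esub>"
    using N.a_subset by (simp add: quotient_module_zero)
  note simps = quotient_module_add[OF N] quotient_module_smult[OF N] zero
    quotient_module_coset_closed
  show ?thesis
  proof (rule moduleI)
    show "abelian_group (quotient_module M N)"
    proof (rule abelian_groupI)
      fix X assume "X \<in> carrier (quotient_module M N)"
      then obtain x where x: "x \<in> carrier M" "X = N +>\<^bsub>M\<^esub> x"
        by (rule quotient_module_cases)
      then have "(N +>\<^bsub>M\<^esub> \<ominus>\<^bsub>M\<^esub> x) \<oplus>\<^bsub>quotient_module M N\<^esub> X = \<zero>\<^bsub>quotient_module M N\<^esub>"
        by (simp add: simps M.l_neg)
      with x show "\<exists>Y\<in>carrier (quotient_module M N).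
          Y \<oplus>\<^bsub>quotient_module M N\<^esub> X = \<zero>\<^bsub>quotient_module M N\<^esub>"
        using quotient_module_coset_closed by (meson M.a_inv_closed)
    qed (auto simp: simps M.a_ac elim!: quotient_module_cases)
  qed (rule R.cring_axioms, (elim quotient_module_cases,
      simp add: simps smult_l_distr smult_r_distr smult_assoc1)+)
qed

section \<open>A ring and its principal ideals as modules\<close>

lemma (in cring) ring_as_module_module: "module R (ring_as_module R)"
proof (rule moduleI)
  show "abelian_group (ring_as_module R)"
  proof (rule abelian_groupI)
    fix x assume "x \<in> carrier (ring_as_module R)"
    then show "\<exists>y\<in>carrier (ring_as_module R).
        y \<oplus>\<^bsub>ring_as_module R\<^esub> x = \<zero>\<^bsub>ring_as_module R\<^esub>"
      by (intro bexI[where x = "\<ominus> x"]) (simp_all add: ring_as_module_def l_neg)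
  qed (simp_all add: ring_as_module_def a_ac)
qed (simp_all add: ring_as_module_def l_distr r_distr m_assoc cring_axioms)

lemma (in cring) cgenideal_submodule:
  assumes "a \<in> carrier R"
  shows "submodule (PIdl a) R (ring_as_module R)"
proof -
  interpret M: module R "ring_as_module R" by (rule ring_as_module_module)
  interpret I: ideal "PIdl a" R using assms by (rule cgenideal_ideal)
  \<comment> \<open>Negation is computed from the additive structure alone, which the ring and its
    module share.\<close>
  have "\<ominus>\<^bsub>ring_as_module R\<^esub> x = \<ominus> x" for x
    by (simp add: ring_as_module_def a_inv_def m_inv_def)
  then show ?thesis
    by (intro M.submoduleI) (auto simp: ring_as_module_def I.I_l_closed dest: I.a_subset[THEN subsetD])
qed

section \<open>Morphic trivial extensions\<close>

text \<open>Multiplication by \<open>b\<close> maps the ring onto \<open>PIdl b\<close>, the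
  annihilator of \<open>a\<close>, and its kernel is the annihilator of \<open>b\<close>, that is
  \<open>PIdl a\<close>. The homomorphism theorem for abelian groups gives the additive isomorphism,
  and linearity is then checked on representatives.\<close>

lemma (in cring) morphic_cringI:
  assumes dual: "\<And>a. a \<in> carrier R \<Longrightarrow>
    \<exists>b\<in>carrier R. annihilator R b = PIdl a \<and> annihilator R a = PIdl b"
  shows "morphic_cring R"
proof
  fix a assume a: "a \<in> carrier R"
  then obtain b where b: "b \<in> carrier R" and ann_b: "annihilator R b = PIdl a"
    and ann_a: "annihilator R a = PIdl b"
    using dual by blast
  let ?A = "ring_as_module R" and ?B = "(ring_as_module R)\<lparr>carrier := annihilator R a\<rparr>"
  interpret M: module R ?A by (rule ring_as_module_module)
  have A: "submodule (PIdl a) R ?A" and B: "submodule (PIdl b) R ?A"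
    using a b by (auto intro: cgenideal_submodule)
  interpret B: module R ?B
    using submodule.submodule_is_module[OF B M.module_axioms] by (simp add: ann_a)
  define h where "h x = x \<otimes> b" for x
  interpret h: abelian_group_hom ?A ?B h
  proof (unfold_locales)
    show "h \<in> hom (add_monoid ?A) (add_monoid ?B)"
      using b by (auto simp: hom_def h_def ring_as_module_def ann_a cgenideal_def l_distr)
  qed
  have ker: "a_kernel ?A ?B h = PIdl a"
    by (auto simp: a_kernel_def kernel_def h_def ring_as_module_def simp flip: ann_b)
      (auto simp: annihilator_def)
  have "h ` carrier ?A = carrier ?B"
    by (auto simp: h_def ring_as_module_def ann_a cgenideal_def)
  note iso = h.A_FactGroup_iso_set[OF this, unfolded ker]
  let ?h = "\<lambda>X. the_elem (h ` X)"
  \<comment> \<open>On a coset of its kernel \<open>h\<close> takes a single value, which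
    \<open>?h\<close> extracts. The quotient module and the factor group have the same carrier and
    addition, so the isomorphism carries over.\<close>
  have "?h \<in> iso (add_monoid (quotient_module ?A (PIdl a))) (add_monoid ?B)"
    using iso by (simp add: iso_def hom_def quotient_module_def A_FactGroup_def')
  moreover have "?h (r \<odot>\<^bsub>quotient_module ?A (PIdl a)\<^esub> X) = r \<odot>\<^bsub>?B\<^esub> ?h X"
    if r: "r \<in> carrier R" and X: "X \<in> carrier (quotient_module ?A (PIdl a))" for r X
  proof -
    have coset: "?h (PIdl a +>\<^bsub>?A\<^esub> x) = h x" if x: "x \<in> carrier R" for x
    proof -
      have "h ` (PIdl a +>\<^bsub>?A\<^esub> x) = {h x}"
      proof -
        have "h (y \<oplus> x) = h x" if "y \<in> PIdl a" for y
          using that x b unfolding ann_b[symmetric]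
          by (auto simp: annihilator_def h_def l_distr)
        moreover have "PIdl a \<noteq> {}" using a cgenideal_self by blast
        ultimately show ?thesis by (auto simp: a_r_coset_def' ring_as_module_def image_UN)
      qed
      then show ?thesis by simp
    qed
    obtain x where x: "x \<in> carrier R" "X = PIdl a +>\<^bsub>?A\<^esub> x"
      using X by (rule M.quotient_module_cases) (auto simp: ring_as_module_def)
    have "r \<odot>\<^bsub>quotient_module ?A (PIdl a)\<^esub> X = PIdl a +>\<^bsub>?A\<^esub> (r \<otimes> x)"
      using M.quotient_module_smult[OF A r] x by (simp add: ring_as_module_def)
    then show ?thesis
      using x r b by (simp add: coset) (simp add: h_def ring_as_module_def m_assoc)
  qed
  ultimately show "module_isomorphic R (quotient_module ?A (PIdl a)) ?B"
    unfolding module_isomorphic_def module_iso_def by blast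
qed

section \<open>Trivial extensions and annihilators\<close>

lemma (in module) trivial_extension_cring: "cring (R \<propto> M)"
proof (rule cringI)
  show "abelian_group (R \<propto> M)"
  proof (rule abelian_groupI)
    fix x assume "x \<in> carrier (R \<propto> M)"
    then show "\<exists>y\<in>carrier (R \<propto> M). y \<oplus>\<^bsub>R \<propto> M\<^esub> x = \<zero>\<^bsub>R \<propto> M\<^esub>"
      by (intro bexI[where x = "(\<ominus> fst x, \<ominus>\<^bsub>M\<^esub> snd x)"])
        (auto simp: trivial_extension_def R.l_neg M.l_neg)
  qed (auto simp: trivial_extension_def R.a_ac M.a_ac)
  show "comm_monoid (R \<propto> M)"
    by (rule comm_monoidI) (auto simp: trivial_extension_def R.m_ac M.a_ac smult_r_distr
        smult_assoc1[symmetric])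
qed (auto simp: trivial_extension_def R.l_distr M.a_ac smult_r_distr smult_l_distr)

text \<open>This isolates what is needed of Q/R. Cyclic submodules Rm correspond to nonzerodivisors
  s: the annihilator of m is Rs and Rm is the s-torsion of \<open>M\<close>. Together with
  divisibility this makes (s, 0) and (0, m) annihilators of each other in the extension. The
  idempotent that generates the annihilator of the first component splits the general case into
  these two shapes.\<close>

lemma (in module) trivial_extension_morphic:
  assumes baer: "weak_baer_cring R"
    and divisible: "\<And>c n. c \<in> nonzerodivisors R \<Longrightarrow> n \<in> carrier M \<Longrightarrow> \<exists>n'\<in>carrier M. c \<odot>\<^bsub>M\<^esub> n' = n"
    and cyclic: "\<And>m. m \<in> carrier M \<Longrightarrow> \<exists>s\<in>nonzerodivisors R.
      {r \<in> carrier R. r \<odot>\<^bsub>M\<^esub> m = \<zero>\<^bsub>M\<^esub>} = PIdl s \<and>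
      {r \<odot>\<^bsub>M\<^esub> m |r. r \<in> carrier R} = {n \<in> carrier M. s \<odot>\<^bsub>M\<^esub> n = \<zero>\<^bsub>M\<^esub>}"
    and inverse: "\<And>s. s \<in> nonzerodivisors R \<Longrightarrow> \<exists>m\<in>carrier M.
      {r \<in> carrier R. r \<odot>\<^bsub>M\<^esub> m = \<zero>\<^bsub>M\<^esub>} = PIdl s \<and>
      {r \<odot>\<^bsub>M\<^esub> m |r. r \<in> carrier R} = {n \<in> carrier M. s \<odot>\<^bsub>M\<^esub> n = \<zero>\<^bsub>M\<^esub>}"
  shows "morphic_cring (R \<propto> M)"
proof -
  interpret baer: weak_baer_cring R by (rule baer)
  interpret S: cring "R \<propto> M" by (rule trivial_extension_cring)
  show ?thesis
  proof (rule S.morphic_cringI)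
    fix \<alpha> assume "\<alpha> \<in> carrier (R \<propto> M)"
    then obtain a m where \<alpha>: "\<alpha> = (a, m)" and [simp]: "a \<in> carrier R" "m \<in> carrier M"
      by (cases \<alpha>) (simp add: trivial_extension_def)
    obtain e where [simp]: "e \<in> carrier R" and ee: "e \<otimes> e = e" and ann_a: "annihilator R a = PIdl e"
      using baer.weak_baer[of a] by auto
    define f where "f = \<one> \<ominus> e"
    \<comment> \<open>Since ec = e and fc = a, the element \<open>c\<close> agrees with
      \<open>a\<close> on the f-part and is 1 on the e-part.\<close>
    define c where "c = a \<oplus> e"
    have [simp]: "f \<in> carrier R" "c \<in> carrier R" by (auto simp: f_def c_def)
    have fe: "f \<oplus> e = \<one>" by (simp add: f_def R.minus_eq R.a_assoc R.l_neg)
    have ea: "e \<otimes> a = \<zero>" using ann_a cgenideal_self[of e] by (auto simp: annihilator_def)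
    have ef: "e \<otimes> f = \<zero>" by (simp add: f_def R.minus_eq R.r_distr R.r_minus ee R.r_neg)
    have ff: "f \<otimes> f = f"
    proof -
      have "f \<otimes> f = f \<otimes> (f \<oplus> e)" using ef by (simp add: r_distr m_comm)
      then show ?thesis by (simp add: fe)
    qed
    have split: "f \<otimes> r \<oplus> e \<otimes> r = r" if "r \<in> carrier R" for r
      using that by (simp add: l_distr[symmetric] fe)
    have splitM: "f \<odot>\<^bsub>M\<^esub> n \<oplus>\<^bsub>M\<^esub> e \<odot>\<^bsub>M\<^esub> n = n" if "n \<in> carrier M" for n
      using that by (simp add: smult_l_distr[symmetric] fe)
    have ec: "e \<otimes> c = e" by (simp add: c_def r_distr ea ee)
    have fc: "f \<otimes> c = a"
    proof -
      have "f \<otimes> a = a" using split[of a] by (simp add: ea)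
      then show ?thesis using ef by (simp add: c_def r_distr m_comm)
    qed
    have cf: "c \<otimes> f = a" using fc by (simp add: m_comm)
    have c: "c \<in> nonzerodivisors R"
    proof -
      have "x = \<zero>" if x: "x \<in> carrier R" "x \<otimes> c = \<zero>" for x
      proof -
        \<comment> \<open>If xc = 0, multiplying by e gives xe = 0. Then xa = 0 too, so x lies in
          Re, and therefore x = xe = 0.\<close>
        have "x \<otimes> e = x \<otimes> (e \<otimes> c)" by (simp add: ec)
        also have "\<dots> = (x \<otimes> c) \<otimes> e" using x(1) by (simp add: m_ac)
        finally have "x \<otimes> e = (x \<otimes> c) \<otimes> e" .
        then have xe: "x \<otimes> e = \<zero>" using x by simp
        then have "x \<otimes> a = \<zero>" using x by (simp add: c_def r_distr)
        then have "x \<in> PIdl e" unfolding ann_a[symmetric] using x(1) by (simp add: annihilator_def)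
        then obtain y where "y \<in> carrier R" "x = y \<otimes> e"
          unfolding cgenideal_def by blast
        then show ?thesis using xe ee by (simp add: m_assoc)
      qed
      then show ?thesis by (simp add: nonzerodivisors_def)
    qed
    obtain s where s: "s \<in> nonzerodivisors R"
      and ann_m: "{r \<in> carrier R. r \<odot>\<^bsub>M\<^esub> m = \<zero>\<^bsub>M\<^esub>} = PIdl s"
      and mult_m: "{r \<odot>\<^bsub>M\<^esub> m |r. r \<in> carrier R} = {n \<in> carrier M. s \<odot>\<^bsub>M\<^esub> n = \<zero>\<^bsub>M\<^esub>}"
      using cyclic[of m] by auto
    \<comment> \<open>In Q/R such a \<open>j\<close> is the class of 1/c.\<close>
    obtain j where [simp]: "j \<in> carrier M"
      and ann_j: "{r \<in> carrier R. r \<odot>\<^bsub>M\<^esub> j = \<zero>\<^bsub>M\<^esub>} = PIdl c"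
      and mult_j: "{r \<odot>\<^bsub>M\<^esub> j |r. r \<in> carrier R} = {n \<in> carrier M. c \<odot>\<^bsub>M\<^esub> n = \<zero>\<^bsub>M\<^esub>}"
      using inverse[OF c] by auto
    have [simp]: "s \<in> carrier R" using s by (simp add: nonzerodivisors_def)
    \<comment> \<open>On the e-part \<alpha> is (0, m), with partner (s, 0). On the f-part it
      generates the same ideal as (c, 0), with partner (0, j). The two partners are glued along e +
      f = 1.\<close>
    define \<beta> where "\<beta> = (e \<otimes> s, f \<odot>\<^bsub>M\<^esub> j)"
    have \<beta>: "\<beta> \<in> carrier (R \<propto> M)" by (simp add: \<beta>_def trivial_extension_def)
    have \<alpha>': "\<alpha> \<in> carrier (R \<propto> M)" by (simp add: \<alpha> trivial_extension_def)
    have sm: "s \<odot>\<^bsub>M\<^esub> m = \<zero>\<^bsub>M\<^esub>" using ann_m cgenideal_self[of s] by auto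
    have cj: "c \<odot>\<^bsub>M\<^esub> j = \<zero>\<^bsub>M\<^esub>" using ann_j cgenideal_self[of c] by auto
    have aj: "a \<odot>\<^bsub>M\<^esub> (f \<odot>\<^bsub>M\<^esub> j) = \<zero>\<^bsub>M\<^esub>"
    proof -
      have "a \<odot>\<^bsub>M\<^esub> (f \<odot>\<^bsub>M\<^esub> j) = (f \<otimes> f) \<odot>\<^bsub>M\<^esub> (c \<odot>\<^bsub>M\<^esub> j)"
        unfolding fc[symmetric] by (simp add: smult_assoc1[symmetric] m_ac)
      then show ?thesis by (simp add: cj)
    qed
    have em: "(e \<otimes> s) \<odot>\<^bsub>M\<^esub> m = \<zero>\<^bsub>M\<^esub>" by (simp add: smult_assoc1 sm)
    \<comment> \<open>By commutativity this one product yields both easy inclusions, of each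
      principal ideal in the annihilator of the other generator.\<close>
    have "\<beta> \<otimes>\<^bsub>R \<propto> M\<^esub> \<alpha> = \<zero>\<^bsub>R \<propto> M\<^esub>"
    proof -
      have "(e \<otimes> s) \<otimes> a = (e \<otimes> a) \<otimes> s" by (simp add: m_ac)
      then show ?thesis by (simp add: \<alpha> \<beta>_def trivial_extension_def em aj ea)
    qed
    then have zero: "\<beta> \<otimes>\<^bsub>R \<propto> M\<^esub> \<alpha> = \<zero>\<^bsub>R \<propto> M\<^esub>" "\<alpha> \<otimes>\<^bsub>R \<propto> M\<^esub> \<beta> = \<zero>\<^bsub>R \<propto> M\<^esub>"
      using S.m_comm \<alpha>' \<beta> by auto
    have "x \<in> PIdl\<^bsub>R \<propto> M\<^esub> \<beta>" if ann: "x \<in> annihilator (R \<propto> M) \<alpha>" for x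
    proof -
      obtain r n where x: "x = (r, n)" and [simp]: "r \<in> carrier R" "n \<in> carrier M"
        and ra: "r \<otimes> a = \<zero>" and rm_an: "r \<odot>\<^bsub>M\<^esub> m \<oplus>\<^bsub>M\<^esub> a \<odot>\<^bsub>M\<^esub> n = \<zero>\<^bsub>M\<^esub>"
        using ann by (auto simp: annihilator_def trivial_extension_def \<alpha>)
      have re: "e \<otimes> r = r"
      proof -
        have "r \<in> PIdl e" unfolding ann_a[symmetric] using ra by (simp add: annihilator_def)
        then obtain y where "y \<in> carrier R" "r = y \<otimes> e"
          unfolding cgenideal_def by blast
        then have "r \<otimes> e = r" using ee by (simp add: m_assoc)
        then show ?thesis by (simp add: m_comm)
      qed
      \<comment> \<open>Here r = er and ea = 0, so applying e to rm + an = 0 leaves rm = 0. The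
        equation thus splits into rm = 0 and an = 0.\<close>
      have rm: "r \<odot>\<^bsub>M\<^esub> m = \<zero>\<^bsub>M\<^esub>"
      proof -
        have "r \<odot>\<^bsub>M\<^esub> m = e \<odot>\<^bsub>M\<^esub> (r \<odot>\<^bsub>M\<^esub> m \<oplus>\<^bsub>M\<^esub> a \<odot>\<^bsub>M\<^esub> n)"
          by (simp add: smult_r_distr smult_assoc1[symmetric] re ea)
        then show ?thesis by (simp add: rm_an)
      qed
      then have an: "a \<odot>\<^bsub>M\<^esub> n = \<zero>\<^bsub>M\<^esub>" using rm_an by simp
      have "r \<in> PIdl s" unfolding ann_m[symmetric] using rm by simp
      then obtain r' where [simp]: "r' \<in> carrier R" and r': "r = r' \<otimes> s"
        unfolding cgenideal_def by blast
      have "c \<odot>\<^bsub>M\<^esub> (f \<odot>\<^bsub>M\<^esub> n) = \<zero>\<^bsub>M\<^esub>"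
        using an by (simp add: smult_assoc1[symmetric] cf)
      then have "f \<odot>\<^bsub>M\<^esub> n \<in> {r \<odot>\<^bsub>M\<^esub> j |r. r \<in> carrier R}"
        unfolding mult_j by simp
      then obtain k where [simp]: "k \<in> carrier R" and k: "f \<odot>\<^bsub>M\<^esub> n = k \<odot>\<^bsub>M\<^esub> j"
        by auto
      obtain n' where [simp]: "n' \<in> carrier M" and n': "s \<odot>\<^bsub>M\<^esub> n' = n"
        using divisible[OF s, of n] by auto
      \<comment> \<open>The first entry of the multiplier uses r = r's on the e-part and fn = kj on
        the f-part; the second entry supplies the missing en, because (es)n' = en.\<close>
      let ?\<gamma> = "(e \<otimes> r' \<oplus> f \<otimes> k, n')"
      have "(e \<otimes> r' \<oplus> f \<otimes> k) \<otimes> (e \<otimes> s) = (e \<otimes> e) \<otimes> (r' \<otimes> s) \<oplus> (e \<otimes> f) \<otimes> (k \<otimes> s)"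
        by (simp add: l_distr r_distr m_ac)
      also have "\<dots> = r" by (simp add: ee ef re r'[symmetric])
      finally have 1: "(e \<otimes> r' \<oplus> f \<otimes> k) \<otimes> (e \<otimes> s) = r" .
      have "(e \<otimes> r' \<oplus> f \<otimes> k) \<odot>\<^bsub>M\<^esub> (f \<odot>\<^bsub>M\<^esub> j) = (((e \<otimes> f) \<otimes> r') \<oplus> (f \<otimes> f) \<otimes> k) \<odot>\<^bsub>M\<^esub> j"
        by (simp add: smult_assoc1[symmetric] l_distr r_distr m_ac)
      also have "\<dots> = f \<odot>\<^bsub>M\<^esub> (f \<odot>\<^bsub>M\<^esub> n)" by (simp add: ef ff k smult_assoc1)
      also have "\<dots> = f \<odot>\<^bsub>M\<^esub> n" by (simp add: smult_assoc1[symmetric] ff)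
      finally have 2: "(e \<otimes> r' \<oplus> f \<otimes> k) \<odot>\<^bsub>M\<^esub> (f \<odot>\<^bsub>M\<^esub> j) = f \<odot>\<^bsub>M\<^esub> n" .
      have 3: "(e \<otimes> s) \<odot>\<^bsub>M\<^esub> n' = e \<odot>\<^bsub>M\<^esub> n" by (simp add: smult_assoc1 n')
      have "x = ?\<gamma> \<otimes>\<^bsub>R \<propto> M\<^esub> \<beta>"
        by (simp add: x \<beta>_def trivial_extension_def 1 2 3 splitM)
      moreover have "?\<gamma> \<in> carrier (R \<propto> M)" by (simp add: trivial_extension_def)
      ultimately show ?thesis by (auto simp: cgenideal_def)
    qed
    moreover have "x \<in> PIdl\<^bsub>R \<propto> M\<^esub> \<alpha>" if ann: "x \<in> annihilator (R \<propto> M) \<beta>" for x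
    proof -
      obtain r n where x: "x = (r, n)" and [simp]: "r \<in> carrier R" "n \<in> carrier M"
        and "r \<otimes> (e \<otimes> s) = \<zero>" and rj_sn: "r \<odot>\<^bsub>M\<^esub> (f \<odot>\<^bsub>M\<^esub> j) \<oplus>\<^bsub>M\<^esub> (e \<otimes> s) \<odot>\<^bsub>M\<^esub> n = \<zero>\<^bsub>M\<^esub>"
        using ann by (auto simp: annihilator_def trivial_extension_def \<beta>_def)
      \<comment> \<open>Cancelling the nonzerodivisor \<open>s\<close> shows that r lies in the
        f-part.\<close>
      then have "(r \<otimes> e) \<otimes> s = \<zero>" by (simp add: m_ac)
      then have er: "e \<otimes> r = \<zero>" using s by (simp add: nonzerodivisors_def m_comm)
      then have fr: "f \<otimes> r = r" using split[of r] by simp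
      \<comment> \<open>Applying f to the second component kills the multiple of es and leaves rj,
        since r = fr.\<close>
      have rj: "r \<odot>\<^bsub>M\<^esub> j = \<zero>\<^bsub>M\<^esub>"
      proof -
        have "r \<odot>\<^bsub>M\<^esub> j = f \<odot>\<^bsub>M\<^esub> (r \<odot>\<^bsub>M\<^esub> (f \<odot>\<^bsub>M\<^esub> j) \<oplus>\<^bsub>M\<^esub> (e \<otimes> s) \<odot>\<^bsub>M\<^esub> n)"
          using fr ef ff by (simp add: smult_r_distr smult_assoc1[symmetric] m_assoc[symmetric])
            (simp add: m_comm)
        then show ?thesis by (simp add: rj_sn)
      qed
      have "r \<odot>\<^bsub>M\<^esub> (f \<odot>\<^bsub>M\<^esub> j) = \<zero>\<^bsub>M\<^esub>"
        using rj fr by (simp add: smult_assoc1[symmetric] m_comm)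
      then have sn: "s \<odot>\<^bsub>M\<^esub> (e \<odot>\<^bsub>M\<^esub> n) = \<zero>\<^bsub>M\<^esub>"
        using rj_sn by (simp add: smult_assoc1[symmetric] m_comm)
      have "r \<in> PIdl c" unfolding ann_j[symmetric] using rj by simp
      then obtain k where [simp]: "k \<in> carrier R" and k: "r = k \<otimes> c"
        unfolding cgenideal_def by blast
      have "e \<odot>\<^bsub>M\<^esub> n \<in> {r \<odot>\<^bsub>M\<^esub> m |r. r \<in> carrier R}"
        unfolding mult_m using sn by simp
      then obtain l where [simp]: "l \<in> carrier R" and l: "e \<odot>\<^bsub>M\<^esub> n = l \<odot>\<^bsub>M\<^esub> m"
        by auto
      \<comment> \<open>Multiplying \<alpha> by an element with first entry fk + el puts the
        unwanted term (fk)m into the second component. Subtracting km before dividing by c makes an'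
        = fn - (fk)m cancel it.\<close>
      obtain n' where [simp]: "n' \<in> carrier M" and n': "c \<odot>\<^bsub>M\<^esub> n' = n \<ominus>\<^bsub>M\<^esub> k \<odot>\<^bsub>M\<^esub> m"
        using divisible[OF c, of "n \<ominus>\<^bsub>M\<^esub> k \<odot>\<^bsub>M\<^esub> m"] by auto
      let ?\<gamma> = "(f \<otimes> k \<oplus> e \<otimes> l, n')"
      have "(f \<otimes> k \<oplus> e \<otimes> l) \<otimes> a = f \<otimes> f \<otimes> (k \<otimes> c) \<oplus> (e \<otimes> a) \<otimes> l"
        by (simp add: l_distr r_distr m_ac flip: fc)
      also have "\<dots> = r" by (simp add: ff ea fr flip: k)
      finally have 1: "(f \<otimes> k \<oplus> e \<otimes> l) \<otimes> a = r" .
      have "a \<odot>\<^bsub>M\<^esub> n' = f \<odot>\<^bsub>M\<^esub> n \<ominus>\<^bsub>M\<^esub> (f \<otimes> k) \<odot>\<^bsub>M\<^esub> m"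
        by (simp add: smult_assoc1 n' M.minus_eq smult_r_distr smult_r_minus flip: fc)
      moreover have "(f \<otimes> k \<oplus> e \<otimes> l) \<odot>\<^bsub>M\<^esub> m = (f \<otimes> k) \<odot>\<^bsub>M\<^esub> m \<oplus>\<^bsub>M\<^esub> e \<odot>\<^bsub>M\<^esub> n"
        by (simp add: smult_l_distr smult_assoc1 flip: l) (simp add: ee flip: smult_assoc1)
      ultimately have "(f \<otimes> k \<oplus> e \<otimes> l) \<odot>\<^bsub>M\<^esub> m \<oplus>\<^bsub>M\<^esub> a \<odot>\<^bsub>M\<^esub> n' = f \<odot>\<^bsub>M\<^esub> n \<oplus>\<^bsub>M\<^esub> e \<odot>\<^bsub>M\<^esub> n"
        by (simp add: M.minus_eq M.a_ac M.r_neg)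
      then have 2: "(f \<otimes> k \<oplus> e \<otimes> l) \<odot>\<^bsub>M\<^esub> m \<oplus>\<^bsub>M\<^esub> a \<odot>\<^bsub>M\<^esub> n' = n"
        by (simp add: splitM)
      have "x = ?\<gamma> \<otimes>\<^bsub>R \<propto> M\<^esub> \<alpha>"
        by (simp add: x \<alpha> trivial_extension_def 1 2)
      moreover have "?\<gamma> \<in> carrier (R \<propto> M)" by (simp add: trivial_extension_def)
      ultimately show ?thesis by (auto simp: cgenideal_def)
    qed
    moreover have "PIdl\<^bsub>R \<propto> M\<^esub> \<beta> \<subseteq> annihilator (R \<propto> M) \<alpha>"
      "PIdl\<^bsub>R \<propto> M\<^esub> \<alpha> \<subseteq> annihilator (R \<propto> M) \<beta>"
      using \<alpha>' \<beta> by (auto simp: cgenideal_def annihilator_def S.m_assoc zero)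
    ultimately show "\<exists>\<beta>\<in>carrier (R \<propto> M).
        annihilator (R \<propto> M) \<beta> = PIdl\<^bsub>R \<propto> M\<^esub> \<alpha> \<and> annihilator (R \<propto> M) \<alpha> = PIdl\<^bsub>R \<propto> M\<^esub> \<beta>"
      using \<beta> by (intro bexI[of _ \<beta>] conjI subset_antisym subsetI) auto
  qed
qed

section \<open>The module \<open>Q/R\<close>\<close>

lemma (in cring) fractions_nonzerodivisors: "fractions R (nonzerodivisors R)"
  by (intro fractions.intro nonzerodivisors_submonoid cring_axioms)

lemma (in cring) quotients_module_simps:
  "carrier (quotients_module R) = carrier (classical_quotients R)"
  "\<zero>\<^bsub>quotients_module R\<^esub> = \<zero>\<^bsub>classical_quotients R\<^esub>"
  "x \<oplus>\<^bsub>quotients_module R\<^esub> y = x \<oplus>\<^bsub>classical_quotients R\<^esub> y"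
  "r \<odot>\<^bsub>quotients_module R\<^esub> x = to_quotients R r \<otimes>\<^bsub>classical_quotients R\<^esub> x"
  by (simp_all add: quotients_module_def ring.defs module.defs)

lemma (in cring) to_quotients_hom: "to_quotients R \<in> ring_hom R (classical_quotients R)"
proof -
  interpret F: fractions R "nonzerodivisors R" by (rule fractions_nonzerodivisors)
  show ?thesis
    by (rule ring_hom_memI)
      (auto simp: to_quotients_def classical_quotients_def F.frac_closed F.frac_simps)
qed

text \<open>This is restriction of scalars along the ring homomorphism
  \<open>to_quotients R\<close>, so the module laws come from the ring laws of Q.\<close>

lemma (in cring) quotients_module_module: "module R (quotients_module R)"
proof -
  interpret F: fractions R "nonzerodivisors R" by (rule fractions_nonzerodivisors)
  interpret Q: cring "classical_quotients R"
    unfolding classical_quotients_def by (rule F.localization_cring)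
  interpret h: ring_hom_cring R "classical_quotients R" "to_quotients R"
    by unfold_locales (rule to_quotients_hom)
  note simps = quotients_module_simps
  show ?thesis
  proof (rule moduleI)
    show "abelian_group (quotients_module R)"
    proof (rule abelian_groupI)
      fix x assume "x \<in> carrier (quotients_module R)"
      then show "\<exists>y\<in>carrier (quotients_module R).
          y \<oplus>\<^bsub>quotients_module R\<^esub> x = \<zero>\<^bsub>quotients_module R\<^esub>"
        by (intro bexI[where x = "\<ominus>\<^bsub>classical_quotients R\<^esub> x"]) (simp_all add: simps Q.l_neg)
    qed (simp_all add: simps Q.a_ac)
  qed (simp_all add: simps Q.l_distr Q.r_distr Q.m_assoc cring_axioms)
qed

lemma (in cring) frac_smult:
  assumes "r \<in> carrier R" "a \<in> carrier R" "s \<in> nonzerodivisors R"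
  shows "r \<odot>\<^bsub>quotients_module R\<^esub> frac R (nonzerodivisors R) a s
    = frac R (nonzerodivisors R) (r \<otimes> a) s"
proof -
  interpret F: fractions R "nonzerodivisors R" by (rule fractions_nonzerodivisors)
  show ?thesis
    using assms by (simp add: quotients_module_simps to_quotients_def classical_quotients_def
        F.frac_simps)
qed

lemma (in cring) to_quotients_image_submodule: "submodule (to_quotients R ` carrier R) R (quotients_module R)"
proof -
  interpret F: fractions R "nonzerodivisors R" by (rule fractions_nonzerodivisors)
  interpret Q: module R "quotients_module R" by (rule quotients_module_module)
  interpret C: cring "classical_quotients R"
    unfolding classical_quotients_def by (rule F.localization_cring)
  interpret h: ring_hom_cring R "classical_quotients R" "to_quotients R"
    by unfold_locales (rule to_quotients_hom)
  have smult: "a \<odot>\<^bsub>quotients_module R\<^esub> to_quotients R x = to_quotients R (a \<otimes> x)"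
    if "a \<in> carrier R" "x \<in> carrier R" for a x
    using that by (simp add: quotients_module_simps)
  show ?thesis
  proof (rule Q.submoduleI)
    show "to_quotients R ` carrier R \<subseteq> carrier (quotients_module R)"
      by (auto simp: quotients_module_simps)
    show "\<zero>\<^bsub>quotients_module R\<^esub> \<in> to_quotients R ` carrier R"
      by (auto simp: quotients_module_simps simp flip: h.hom_zero)
  next
    fix a assume "a \<in> to_quotients R ` carrier R"
    then obtain x where x: "x \<in> carrier R" "a = to_quotients R x" by blast
    then have "a \<in> carrier (quotients_module R)" by (simp add: quotients_module_simps)
    \<comment> \<open>As a scalar multiple by -1, the negative stays in the image by the rule
      \<open>smult\<close>.\<close>
    then have "\<ominus>\<^bsub>quotients_module R\<^esub> a = (\<ominus> \<one>) \<odot>\<^bsub>quotients_module R\<^esub> a"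
      by (simp add: Q.smult_l_minus)
    also have "\<dots> = to_quotients R (\<ominus> \<one> \<otimes> x)"
      unfolding x(2) using x(1) by (intro smult) auto
    finally show "\<ominus>\<^bsub>quotients_module R\<^esub> a \<in> to_quotients R ` carrier R"
      using x(1) by blast
  next
    fix a b assume "a \<in> to_quotients R ` carrier R" "b \<in> to_quotients R ` carrier R"
    then show "a \<oplus>\<^bsub>quotients_module R\<^esub> b \<in> to_quotients R ` carrier R"
      by (auto simp: quotients_module_simps simp flip: h.hom_add)
  next
    fix a x assume a: "a \<in> carrier R" and "x \<in> to_quotients R ` carrier R"
    then obtain y where y: "y \<in> carrier R" "x = to_quotients R y" by blast
    show "a \<odot>\<^bsub>quotients_module R\<^esub> x \<in> to_quotients R ` carrier R"
      unfolding y(2) smult[OF a y(1)] using a y(1) by blast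
  qed
qed

lemma (in cring) Q_mod_R_module: "module R (Q_mod_R R)"
  unfolding Q_mod_R_def
  by (rule module.quotient_module_module[OF quotients_module_module to_quotients_image_submodule])

section \<open>Computing with classes of fractions modulo R\<close>

definition frac_class :: "('a, 'b) ring_scheme \<Rightarrow> 'a \<Rightarrow> 'a \<Rightarrow> ('a \<times> 'a) set set"
  where "frac_class R a s =
    to_quotients R ` carrier R +>\<^bsub>quotients_module R\<^esub> frac R (nonzerodivisors R) a s"

context cring
begin

lemma frac_in_quotients_module:
  "a \<in> carrier R \<Longrightarrow> s \<in> nonzerodivisors R \<Longrightarrow>
    frac R (nonzerodivisors R) a s \<in> carrier (quotients_module R)"
  using fractions.frac_closed[OF fractions_nonzerodivisors]
  by (simp add: quotients_module_simps classical_quotients_def)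

lemma frac_class_closed:
  "a \<in> carrier R \<Longrightarrow> s \<in> nonzerodivisors R \<Longrightarrow> frac_class R a s \<in> carrier (Q_mod_R R)"
  unfolding frac_class_def Q_mod_R_def
  by (intro module.quotient_module_coset_closed[OF quotients_module_module]
      frac_in_quotients_module)

lemma Q_mod_R_cases:
  assumes "n \<in> carrier (Q_mod_R R)"
  obtains a s where "a \<in> carrier R" "s \<in> nonzerodivisors R" "n = frac_class R a s"
proof -
  obtain q where q: "q \<in> carrier (quotients_module R)"
    "n = to_quotients R ` carrier R +>\<^bsub>quotients_module R\<^esub> q"
    using assms unfolding Q_mod_R_def
    by (rule module.quotient_module_cases[OF quotients_module_module])
  then show thesis
    using fractions.localization_cases[OF fractions_nonzerodivisors, of q] that
    by (auto simp: quotients_module_simps classical_quotients_def frac_class_def)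
qed

lemma frac_class_smult:
  assumes "r \<in> carrier R" "a \<in> carrier R" "s \<in> nonzerodivisors R"
  shows "r \<odot>\<^bsub>Q_mod_R R\<^esub> frac_class R a s = frac_class R (r \<otimes> a) s"
  using assms module.quotient_module_smult[OF quotients_module_module to_quotients_image_submodule]
  by (simp add: frac_class_def Q_mod_R_def frac_in_quotients_module frac_smult)

text \<open>The equation says a/s = b/t + k, so the two fractions differ by an element of R. Taking
  \<open>k\<close> to be zero gives plain equality of fractions.\<close>

lemma frac_class_eqI:
  assumes a: "a \<in> carrier R" "s \<in> nonzerodivisors R" and b: "b \<in> carrier R" "t \<in> nonzerodivisors R"
    and k: "k \<in> carrier R" and eq: "t \<otimes> a = s \<otimes> (b \<oplus> t \<otimes> k)"
  shows "frac_class R a s = frac_class R b t"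
proof -
  interpret F: fractions R "nonzerodivisors R" by (rule fractions_nonzerodivisors)
  let ?f = "frac R (nonzerodivisors R)"
  have [simp]: "t \<in> carrier R" using b by simp
  have "?f a s = ?f (b \<oplus> t \<otimes> k) t"
    using a b k eq by (intro F.frac_eqI) auto
  also have "\<dots> = to_quotients R k \<oplus>\<^bsub>quotients_module R\<^esub> ?f b t"
    using a b k by (simp add: to_quotients_def quotients_module_simps classical_quotients_def
        F.frac_simps a_comm)
  finally have "?f a s \<in> to_quotients R ` carrier R +>\<^bsub>quotients_module R\<^esub> ?f b t"
    using k by (auto simp: a_r_coset_def')
  then show ?thesis
    using module.coset_eq_iff[OF quotients_module_module to_quotients_image_submodule] a b
    by (simp add: frac_class_def frac_in_quotients_module)
qed

text \<open>The class vanishes when a/s = k/1 for some k in R. The factor in the equality of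
  fractions is a nonzerodivisor and can be cancelled, which leaves a = sk.\<close>

lemma frac_class_eq_zero_iff:
  assumes a: "a \<in> carrier R" "s \<in> nonzerodivisors R"
  shows "frac_class R a s = \<zero>\<^bsub>Q_mod_R R\<^esub> \<longleftrightarrow> a \<in> PIdl s"
proof -
  interpret F: fractions R "nonzerodivisors R" by (rule fractions_nonzerodivisors)
  interpret M: module R "quotients_module R" by (rule quotients_module_module)
  interpret N: abelian_subgroup "to_quotients R ` carrier R" "quotients_module R"
    by (rule M.abelian_subgroup_submodule[OF to_quotients_image_submodule])
  let ?f = "frac R (nonzerodivisors R)" and ?N = "to_quotients R ` carrier R"
  have [simp]: "s \<in> carrier R" using a by simp
  have q: "?f a s \<in> carrier (quotients_module R)" using a by (rule frac_in_quotients_module)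
  have "frac_class R a s = \<zero>\<^bsub>Q_mod_R R\<^esub> \<longleftrightarrow> ?f a s \<in> ?N"
    using q N.a_rcos_self[OF q] N.a_rcos_const
    by (auto simp: frac_class_def Q_mod_R_def M.quotient_module_zero)
  also have "\<dots> \<longleftrightarrow> (\<exists>k\<in>carrier R. ?f a s = ?f k \<one>)"
    by (simp add: image_iff to_quotients_def)
  also have "\<dots> \<longleftrightarrow> (\<exists>k\<in>carrier R. a = s \<otimes> k)"
  proof (intro bex_cong refl)
    fix k assume k: "k \<in> carrier R"
    have "a = s \<otimes> k" if "u \<in> nonzerodivisors R" "u \<otimes> a = u \<otimes> (s \<otimes> k)" for u
      using a k by (intro nonzerodivisors_cancel[OF that(1) _ _ that(2)]) auto
    then show "?f a s = ?f k \<one> \<longleftrightarrow> a = s \<otimes> k"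
      using a k by (auto simp: F.frac_eq_iff)
  qed
  also have "\<dots> \<longleftrightarrow> a \<in> PIdl s"
    by (auto simp: cgenideal_def m_comm)
  finally show ?thesis .
qed

text \<open>The identity makes \<open>x\<close> invertible modulo \<open>s\<close>, so x/s and 1/s
  generate the same submodule of Q/R, namely the s-torsion.\<close>

lemma frac_class_unimodular:
  assumes s: "s \<in> nonzerodivisors R" and [simp]: "x \<in> carrier R" "u \<in> carrier R" "v \<in> carrier R"
    and unimodular: "u \<otimes> x \<oplus> v \<otimes> s = \<one>"
  shows "{r \<in> carrier R. r \<odot>\<^bsub>Q_mod_R R\<^esub> frac_class R x s = \<zero>\<^bsub>Q_mod_R R\<^esub>} = PIdl s"
    and "{r \<odot>\<^bsub>Q_mod_R R\<^esub> frac_class R x s |r. r \<in> carrier R} =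
      {n \<in> carrier (Q_mod_R R). s \<odot>\<^bsub>Q_mod_R R\<^esub> n = \<zero>\<^bsub>Q_mod_R R\<^esub>}"
proof -
  have [simp]: "s \<in> carrier R" using s by (simp add: nonzerodivisors_def)
  \<comment> \<open>Modulo \<open>s\<close>, multiplication by \<open>u\<close> recovers r from
    rx.\<close>
  have scale: "r = u \<otimes> (r \<otimes> x) \<oplus> (r \<otimes> v) \<otimes> s" if "r \<in> carrier R" for r
  proof -
    have "r \<otimes> (u \<otimes> x \<oplus> v \<otimes> s) = u \<otimes> (r \<otimes> x) \<oplus> (r \<otimes> v) \<otimes> s"
      using that by (simp add: r_distr m_ac)
    then show ?thesis using that by (simp add: unimodular)
  qed
  have "r \<otimes> x \<in> PIdl s \<longleftrightarrow> r \<in> PIdl s" if r: "r \<in> carrier R" for r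
  proof
    assume "r \<otimes> x \<in> PIdl s"
    then obtain l where l: "l \<in> carrier R" "r \<otimes> x = l \<otimes> s" by (auto simp: cgenideal_def)
    then have "r = (u \<otimes> l \<oplus> r \<otimes> v) \<otimes> s"
      using scale[OF r] r by (simp add: l_distr m_assoc)
    then show "r \<in> PIdl s" using l r by (auto simp: cgenideal_def)
  next
    assume "r \<in> PIdl s"
    then show "r \<otimes> x \<in> PIdl s"
      using ideal.I_r_closed[OF cgenideal_ideal] by simp
  qed
  moreover have "PIdl s \<subseteq> carrier R" by (auto simp: cgenideal_def)
  ultimately have "{r \<in> carrier R. r \<otimes> x \<in> PIdl s} = PIdl s" by blast
  then show "{r \<in> carrier R. r \<odot>\<^bsub>Q_mod_R R\<^esub> frac_class R x s = \<zero>\<^bsub>Q_mod_R R\<^esub>} = PIdl s"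
    using s by (simp add: frac_class_smult frac_class_eq_zero_iff cong: conj_cong)
  show "{r \<odot>\<^bsub>Q_mod_R R\<^esub> frac_class R x s |r. r \<in> carrier R} =
      {n \<in> carrier (Q_mod_R R). s \<odot>\<^bsub>Q_mod_R R\<^esub> n = \<zero>\<^bsub>Q_mod_R R\<^esub>}" (is "?L = ?R")
  proof (intro subset_antisym subsetI)
    fix n assume "n \<in> ?L"
    then obtain r where r: "r \<in> carrier R" "n = frac_class R (r \<otimes> x) s"
      using s by (auto simp: frac_class_smult)
    moreover have "s \<otimes> (r \<otimes> x) \<in> PIdl s"
      using r ideal.I_r_closed[OF cgenideal_ideal cgenideal_self] by simp
    ultimately show "n \<in> ?R"
      using s by (simp add: frac_class_smult frac_class_eq_zero_iff frac_class_closed)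
  next
    fix n assume n: "n \<in> ?R"
    then obtain y t where [simp]: "y \<in> carrier R" and t: "t \<in> nonzerodivisors R"
      and n_eq: "n = frac_class R y t"
      by (auto elim: Q_mod_R_cases)
    have [simp]: "t \<in> carrier R" using t by (simp add: nonzerodivisors_def)
    \<comment> \<open>Being killed by \<open>s\<close> means that y/t has the form k/s. Expanding k
      by \<open>scale\<close> then exhibits this class as ku times that of x/s, with kv as the
      difference in R.\<close>
    from n obtain k where [simp]: "k \<in> carrier R" and k: "s \<otimes> y = k \<otimes> t"
      using s t by (auto simp: n_eq frac_class_smult frac_class_eq_zero_iff cgenideal_def)
    have "s \<otimes> y = t \<otimes> k" using k by (simp add: m_comm)
    also have "\<dots> = t \<otimes> (u \<otimes> (k \<otimes> x) \<oplus> (k \<otimes> v) \<otimes> s)"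
      using scale[of k] by simp
    also have "\<dots> = t \<otimes> ((k \<otimes> u) \<otimes> x \<oplus> s \<otimes> (k \<otimes> v))" by (simp add: m_ac)
    finally have "n = frac_class R ((k \<otimes> u) \<otimes> x) s"
      using s t unfolding n_eq by (intro frac_class_eqI[of _ _ _ _ "k \<otimes> v"]) auto
    also have "\<dots> = (k \<otimes> u) \<odot>\<^bsub>Q_mod_R R\<^esub> frac_class R x s"
      using s by (simp add: frac_class_smult)
    finally show "n \<in> ?L" by auto
  qed
qed

text \<open>The class of y/t is divided by \<open>c\<close> by enlarging the denominator to
  ct.\<close>

lemma Q_mod_R_divisible:
  assumes c: "c \<in> nonzerodivisors R" and "n \<in> carrier (Q_mod_R R)"
  shows "\<exists>n'\<in>carrier (Q_mod_R R). c \<odot>\<^bsub>Q_mod_R R\<^esub> n' = n"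
proof -
  interpret S: submonoid "nonzerodivisors R" R by (rule nonzerodivisors_submonoid)
  obtain y t where y: "y \<in> carrier R" "t \<in> nonzerodivisors R" "n = frac_class R y t"
    using assms(2) by (rule Q_mod_R_cases)
  have [simp]: "c \<in> carrier R" "t \<in> carrier R" using c y S.subset by auto
  have "frac_class R (c \<otimes> y) (c \<otimes> t) = frac_class R y t"
    using c y by (intro frac_class_eqI[of _ _ _ _ \<zero>]) (auto simp: m_ac)
  then show ?thesis
    using c y by (intro bexI[of _ "frac_class R y (c \<otimes> t)"])
      (simp_all add: frac_class_smult frac_class_closed)
qed

end

text \<open>This brings x/s to lowest terms: \<open>d\<close> generates the ideal of x and s. Both
  \<open>d\<close> and \<open>s'\<close> divide the nonzerodivisor \<open>s\<close>, hence are
  nonzerodivisors themselves.\<close>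

lemma (in bezout_cring) bezout_identity:
  assumes x: "x \<in> carrier R" and s: "s \<in> nonzerodivisors R"
  obtains d x' s' u v where "d \<in> nonzerodivisors R" "s' \<in> nonzerodivisors R"
    "x' \<in> carrier R" "u \<in> carrier R" "v \<in> carrier R"
    "x = d \<otimes> x'" "s = d \<otimes> s'" "u \<otimes> x' \<oplus> v \<otimes> s' = \<one>"
proof -
  have [simp]: "x \<in> carrier R" "s \<in> carrier R" using x s by (auto simp: nonzerodivisors_def)
  have "principalideal (Idl {x, s}) R" by (rule bezout) auto
  then obtain d where [simp]: "d \<in> carrier R" and d: "Idl {x, s} = PIdl d"
    using principalideal.generate[of "Idl {x, s}" R] cgenideal_eq_genideal by metis
  have "x \<in> PIdl d" "s \<in> PIdl d" using genideal_self[of "{x, s}"] by (auto simp flip: d)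
  then obtain x' s' where [simp]: "x' \<in> carrier R" "s' \<in> carrier R"
    and x': "x = d \<otimes> x'" and s': "s = d \<otimes> s'"
    by (auto simp: cgenideal_def m_comm)
  have ideal: "ideal (PIdl x <+> PIdl s) R"
    by (intro add_ideals cgenideal_ideal) auto
  \<comment> \<open>The generated ideal is defined as an intersection; comparing it with a sum of
    principal ideals produces the coefficients \<open>u\<close> and \<open>v\<close>.\<close>
  have "PIdl d \<subseteq> PIdl x <+> PIdl s"
  proof -
    have "y \<oplus> z \<in> PIdl x <+> PIdl s" if "y \<in> PIdl x" "z \<in> PIdl s" for y z
      using that by (auto simp: set_add_def')
    moreover have "\<zero> \<in> PIdl y" if "y \<in> carrier R" for y
      using that by (intro additive_subgroup.zero_closed ideal.axioms(1) cgenideal_ideal)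
    ultimately have "x \<oplus> \<zero> \<in> PIdl x <+> PIdl s" "\<zero> \<oplus> s \<in> PIdl x <+> PIdl s"
      by (simp_all only: cgenideal_self \<open>x \<in> carrier R\<close> \<open>s \<in> carrier R\<close>)
    then show ?thesis unfolding d[symmetric] using ideal by (intro genideal_minimal) auto
  qed
  then have "d \<in> PIdl x <+> PIdl s" using cgenideal_self[of d] by auto
  then obtain u v where [simp]: "u \<in> carrier R" "v \<in> carrier R"
    and uv: "d = u \<otimes> x \<oplus> v \<otimes> s"
    by (auto simp: set_add_def' cgenideal_def)
  have d_nz: "d \<in> nonzerodivisors R"
  proof -
    have "z = \<zero>" if z: "z \<in> carrier R" "z \<otimes> d = \<zero>" for z
    proof -
      have "z \<otimes> s = (z \<otimes> d) \<otimes> s'" using z(1) by (simp add: s' m_assoc)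
      then show ?thesis using z s by (simp add: nonzerodivisors_def)
    qed
    then show ?thesis by (simp add: nonzerodivisors_def)
  qed
  have s'_nz: "s' \<in> nonzerodivisors R"
  proof -
    have "z = \<zero>" if z: "z \<in> carrier R" "z \<otimes> s' = \<zero>" for z
    proof -
      have "z \<otimes> s = d \<otimes> (z \<otimes> s')" using z(1) by (simp add: s' m_ac)
      then show ?thesis using z s by (simp add: nonzerodivisors_def)
    qed
    then show ?thesis by (simp add: nonzerodivisors_def)
  qed
  \<comment> \<open>The identity for the reduced fraction is d = ux + vs with the factor
    \<open>d\<close> cancelled.\<close>
  have "d \<otimes> (u \<otimes> x' \<oplus> v \<otimes> s') = u \<otimes> (d \<otimes> x') \<oplus> v \<otimes> (d \<otimes> s')"
    by (simp add: r_distr m_ac)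
  also have "\<dots> = d \<otimes> \<one>" by (simp flip: x' s' uv)
  finally have "u \<otimes> x' \<oplus> v \<otimes> s' = \<one>"
    by (rule nonzerodivisors_cancel[OF d_nz, rotated 2]) auto
  with d_nz s'_nz show thesis by (intro that[of d s' x' u v]) (auto simp: x' s')
qed

theorem theorem4p8:
  fixes R (structure)
  assumes "cring R"
    and "reduced_cring R"
    and "bezout_cring R"
    and "weak_baer_cring R"
  shows "morphic_cring (R \<propto> Q_mod_R R)"
proof -
  interpret bezout_cring R by (rule assms)
  show ?thesis
  proof (rule module.trivial_extension_morphic[OF Q_mod_R_module])
    show "weak_baer_cring R" by (rule assms)
  next
    fix m assume "m \<in> carrier (Q_mod_R R)"
    then obtain x s where x: "x \<in> carrier R" "s \<in> nonzerodivisors R" "m = frac_class R x s"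
      by (rule Q_mod_R_cases)
    \<comment> \<open>The denominator belonging to m is that of the reduced fraction x'/s', as the
      annihilator of m need not be generated by the original s.\<close>
    obtain d x' s' u v where d: "d \<in> nonzerodivisors R" and s': "s' \<in> nonzerodivisors R"
      and x': "x' \<in> carrier R" and uv: "u \<in> carrier R" "v \<in> carrier R"
        "u \<otimes> x' \<oplus> v \<otimes> s' = \<one>"
      and eq: "x = d \<otimes> x'" "s = d \<otimes> s'"
      using x(1,2) by (rule bezout_identity)
    have "d \<in> carrier R" "s' \<in> carrier R" using d s' by (auto simp: nonzerodivisors_def)
    then have "m = frac_class R x' s'"
      unfolding x(3) using x(1,2) s' x' by (intro frac_class_eqI[of _ _ _ _ \<zero>]) (auto simp: eq m_ac)
    then show "\<exists>s\<in>nonzerodivisors R.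
        {r \<in> carrier R. r \<odot>\<^bsub>Q_mod_R R\<^esub> m = \<zero>\<^bsub>Q_mod_R R\<^esub>} = PIdl s \<and>
        {r \<odot>\<^bsub>Q_mod_R R\<^esub> m |r. r \<in> carrier R} =
          {n \<in> carrier (Q_mod_R R). s \<odot>\<^bsub>Q_mod_R R\<^esub> n = \<zero>\<^bsub>Q_mod_R R\<^esub>}"
      using frac_class_unimodular[OF s' x' uv] s' by blast
  next
    fix s assume s: "s \<in> nonzerodivisors R"
    \<comment> \<open>The element belonging to s is the class of 1/s, with the trivial coefficients
      u = 1 and v = 0.\<close>
    then have "\<one> \<otimes> \<one> \<oplus> \<zero> \<otimes> s = \<one>" by (simp add: nonzerodivisors_def)
    from frac_class_unimodular[OF s one_closed one_closed zero_closed this]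
    show "\<exists>m\<in>carrier (Q_mod_R R).
        {r \<in> carrier R. r \<odot>\<^bsub>Q_mod_R R\<^esub> m = \<zero>\<^bsub>Q_mod_R R\<^esub>} = PIdl s \<and>
        {r \<odot>\<^bsub>Q_mod_R R\<^esub> m |r. r \<in> carrier R} =
          {n \<in> carrier (Q_mod_R R). s \<odot>\<^bsub>Q_mod_R R\<^esub> n = \<zero>\<^bsub>Q_mod_R R\<^esub>}"
      using frac_class_closed[OF one_closed s] by blast
  qed (rule Q_mod_R_divisible)
qed

end
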